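(* Let $\mathcal{C}_{in}$ be the binary extended Hamming code with parameters $[8,4,4]_2$, with locality $3$. Let $\{\mathcal{C}_{out}^{(i)}\}_{i=1}^\infty$ be a family of algebraic geometry codes with parameters $[n_i,k_i,d_i]_{2^4}$ over $\mathbb{F}_{2^4}$ attaining the Tsfasman–Vlăduţ–Zink bound. Then the concatenated codes (inner code $\mathcal{C}_{in}$, outer codes $\mathcal{C}_{out}^{(i)}$) are a family of $[8n_i,4k_i,4d_i;3]_2$-locally repairable codes with locality $3$ such that its information rate $R$ and relative minimum distance $\delta$ satisfy $$R+\delta\ge \tfrac13 .$$
   Context: An $[n,k,d]_q$-linear code is a $k$-dimensional subspace of $\mathbb{F}_q^n$ with minimum Hamming distance $d$. It has locality $r$ if for every coordinate $i$ there is a set $S\subseteq[n]\setminus\{i\}$, $|S|\le r$, such that codewords agreeing on $S$ also agree at $i$; equivalently, every coordinate $i$ lies in the support of some dual codeword of weight at most $r+1$. An $[n,k,d;r]_q$-locally repairable code is an $[n,k,d]_q$-linear code with locality $r$. Concatenation: for an inner $[n_1,k_1,d_1]_q$ code $\mathcal{C}_{in}$ and outer code $\mathcal{C}_{out}\subseteq\mathbb{F}_{q^{k_1}}^{n_2}$, fix an $\mathbb{F}_q$-linear isomorphism $\varphi:\mathbb{F}_{q^{k_1}}\to\mathcal{C}_{in}$; the concatenated code is $\{(\varphi(c_1),\dots,\varphi(c_{n_2})):(c_1,\dots,c_{n_2})\in\mathcal{C}_{out}\}$. Algebraic geometry code: for a function field $F/\mathbb{F}_Q$ with full constant field $\mathbb{F}_Q$,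 distinct rational places $P_1,\dots,P_n$ and a divisor $G$ with $0<\deg G<n$ whose support contains no $P_j$, it is $\{(f(P_1),\dots,f(P_n)):f\in\mathcal{L}(G)\}$, where $\mathcal{L}(G)$ is the Riemann–Roch space. For a family of codes of lengths $N_i\to\infty$, dimensions $K_i$ and minimum distances $D_i$, the information rate is $\lim K_i/N_i$ and the relative minimum distance is $\lim D_i/N_i$. A family of algebraic geometry codes over $\mathbb{F}_Q$, $Q$ a square, attains the Tsfasman–Vlăduţ–Zink bound if its information rate $R_{out}$ and relative minimum distance $\delta_{out}$ satisfy $R_{out}\ge 1-\frac{1}{\sqrt{Q}-1}-\delta_{out}$; here $Q=16$.
   Formalization: The minimum distance of the concatenated codes is shown to be at least 4d_i, not exactly 4d_i (false e.g. for the [16,2,15]_16 Reed–Solomon code, which gives 64); R+δ ≥ 1/3 is proved for the parameters 4d_i and for the exact distances whenever their limit exists. *)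

theory Defs
  imports
    "HOL-Algebra.Algebra"
    "HOL-Library.Poly_Mapping"
    "HOL-Library.Z2"
    "Jordan_Normal_Form.VS_Connect"
    Complex_Main
begin

section \<open>Linear codes and locality\<close>

definition hamming_distance :: "'a vec \<Rightarrow> 'a vec \<Rightarrow> nat" where
  "hamming_distance u v = card {i. i < dim_vec u \<and> u $ i \<noteq> v $ i}"

text \<open>A relation rather than a function: a code with fewer than two words has no minimum distance.\<close>

definition has_min_distance :: "'a vec set \<Rightarrow> nat \<Rightarrow> bool" where
  "has_min_distance C d \<longleftrightarrow>
     (\<exists>u\<in>C. \<exists>v\<in>C. u \<noteq> v \<and> hamming_distance u v = d) \<and>
     (\<forall>u\<in>C. \<forall>v\<in>C. u \<noteq> v \<longrightarrow> d \<le> hamming_distance u v)"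

definition linear_code :: "nat \<Rightarrow> nat \<Rightarrow> nat \<Rightarrow> 'a::field vec set \<Rightarrow> bool" where
  "linear_code n k d C \<longleftrightarrow>
     VectorSpace.subspace class_ring C (module_vec TYPE('a) n) \<and>
     vectorspace.dim class_ring ((module_vec TYPE('a) n)\<lparr>carrier := C\<rparr>) = k \<and>
     has_min_distance C d"

definition has_locality :: "nat \<Rightarrow> 'a vec set \<Rightarrow> nat \<Rightarrow> bool" where
  "has_locality n C r \<longleftrightarrow>
     (\<forall>i<n. \<exists>S \<subseteq> {..<n} - {i}. card S \<le> r \<and>
        (\<forall>u\<in>C. \<forall>v\<in>C. (\<forall>j\<in>S. u $ j = v $ j) \<longrightarrow> u $ i = v $ i))"

definition locally_repairable_code ::
    "nat \<Rightarrow> nat \<Rightarrow> nat \<Rightarrow> nat \<Rightarrow> 'a::field vec set \<Rightarrow> bool" where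
  "locally_repairable_code n k d r C \<longleftrightarrow> linear_code n k d C \<and> has_locality n C r"

section \<open>The binary extended Hamming code\<close>

text \<open>The columns of the parity-check matrix are the binary expansions of 1, ..., 2^m - 1,
  i.e. all nonzero vectors of length m.\<close>

definition hamming_parity_check :: "nat \<Rightarrow> bit mat" where
  "hamming_parity_check m =
     mat m (2 ^ m - 1) (\<lambda>(b, j). of_bool (odd (Suc j div 2 ^ b)))"

definition hamming_code :: "nat \<Rightarrow> bit vec set" where
  "hamming_code m =
     {x \<in> carrier_vec (2 ^ m - 1). hamming_parity_check m *\<^sub>v x = 0\<^sub>v m}"

definition extend_by_parity :: "'a::ab_group_add vec \<Rightarrow> 'a vec" where
  "extend_by_parity x = x @\<^sub>v vec 1 (\<lambda>_. - (\<Sum>i<dim_vec x. x $ i))"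

definition extended_hamming_code :: "bit vec set" where
  "extended_hamming_code = extend_by_parity ` hamming_code 3"

section \<open>Concatenation\<close>

text \<open>The extension field is a type \<open>'e\<close>; its structure as a vector space over \<open>'b\<close> is
  given by a field embedding \<open>emb\<close>.\<close>

definition linear_iso :: "('b::field \<Rightarrow> 'e::field) \<Rightarrow> ('e \<Rightarrow> 'b vec) \<Rightarrow> 'b vec set \<Rightarrow> bool" where
  "linear_iso emb \<phi> C \<longleftrightarrow>
     bij_betw \<phi> UNIV C \<and>
     (\<forall>x y. \<phi> (x + y) = \<phi> x + \<phi> y) \<and>
     (\<forall>a x. \<phi> (emb a * x) = a \<cdot>\<^sub>v \<phi> x)"

definition concatenated_code ::
    "nat \<Rightarrow> nat \<Rightarrow> ('e \<Rightarrow> 'b vec) \<Rightarrow> 'e vec set \<Rightarrow> 'b vec set" where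
  "concatenated_code n1 n2 \<phi> C =
     (\<lambda>c. vec (n1 * n2) (\<lambda>i. \<phi> (c $ (i div n1)) $ (i mod n1))) ` C"

section \<open>Function fields and algebraic geometry codes\<close>

text \<open>An algebraic function field in one variable, with full constant field the image of the
  field type \<open>'q\<close> under \<open>const\<close>.\<close>

locale function_field = Ring.field F for F :: "('f, 'm) ring_scheme" (structure) +
  fixes const :: "'q::field \<Rightarrow> 'f"
  assumes const_hom: "const \<in> Ring.ring_hom class_ring F"
    and finite_over_rational:
      "\<exists>x\<in>carrier F. (transcendental over (range const)) x \<and>
         finite_dimension (generate_field F (insert x (range const))) (carrier F)"
    and full_constant_field:
      "\<And>x. x \<in> carrier F \<Longrightarrow> (algebraic over (range const)) x \<Longrightarrow> x \<in> range const"
begin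

definition valuation_ring :: "'f set \<Rightarrow> bool" where
  "valuation_ring A \<longleftrightarrow>
     subring A F \<and> range const \<subset> A \<and> A \<subset> carrier F \<and>
     (\<forall>z\<in>carrier F - {\<zero>}. z \<in> A \<or> inv z \<in> A)"

text \<open>A place is the maximal ideal of a valuation ring; it determines that ring.\<close>

definition places :: "'f set set" where
  "places = {A - Units (F\<lparr>carrier := A\<rparr>) | A. valuation_ring A}"

definition place_ring :: "'f set \<Rightarrow> 'f set" where
  "place_ring P = {z \<in> carrier F. z = \<zero> \<or> inv z \<notin> P}"

definition residue_field :: "'f set \<Rightarrow> 'f set ring" where
  "residue_field P = (F\<lparr>carrier := place_ring P\<rparr>) Quot P"

definition place_degree :: "'f set \<Rightarrow> nat" where
  "place_degree P =
     ring.dim (residue_field P) (range (\<lambda>a. P +> const a)) (carrier (residue_field P))"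

definition rational_place :: "'f set \<Rightarrow> bool" where
  "rational_place P \<longleftrightarrow> P \<in> places \<and> place_degree P = 1"

text \<open>The value in the constant field of \<open>f\<close>, regular at a rational place \<open>P\<close>: the
  constant with the same residue class as \<open>f\<close>.\<close>

definition eval_at :: "'f \<Rightarrow> 'f set \<Rightarrow> 'q" where
  "eval_at f P = (THE a. f \<ominus> const a \<in> P)"

definition prime_element :: "'f set \<Rightarrow> 'f \<Rightarrow> bool" where
  "prime_element P t \<longleftrightarrow> t \<in> carrier F \<and> P = (\<lambda>z. t \<otimes> z) ` place_ring P"

text \<open>The normalized discrete valuation, meaningful for \<open>f \<noteq> \<zero>\<close>.\<close>

definition valuation :: "'f set \<Rightarrow> 'f \<Rightarrow> int" where
  "valuation P f =
     (THE n. \<exists>t u. prime_element P t \<and> u \<in> Units (F\<lparr>carrier := place_ring P\<rparr>) \<and>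
        f = t [^] n \<otimes> u)"

definition divisor :: "('f set \<Rightarrow>\<^sub>0 int) \<Rightarrow> bool" where
  "divisor G \<longleftrightarrow> Poly_Mapping.keys G \<subseteq> places"

definition divisor_degree :: "('f set \<Rightarrow>\<^sub>0 int) \<Rightarrow> int" where
  "divisor_degree G =
     (\<Sum>P\<in>Poly_Mapping.keys G. Poly_Mapping.lookup G P * int (place_degree P))"

definition riemann_roch_space :: "('f set \<Rightarrow>\<^sub>0 int) \<Rightarrow> 'f set" where
  "riemann_roch_space G =
     {f \<in> carrier F. f = \<zero> \<or> (\<forall>P\<in>places. valuation P f \<ge> - Poly_Mapping.lookup G P)}"

definition ag_code_data :: "nat \<Rightarrow> (nat \<Rightarrow> 'f set) \<Rightarrow> ('f set \<Rightarrow>\<^sub>0 int) \<Rightarrow> bool" where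
  "ag_code_data n P G \<longleftrightarrow>
     inj_on P {..<n} \<and> (\<forall>j<n. rational_place (P j)) \<and>
     divisor G \<and> 0 < divisor_degree G \<and> divisor_degree G < int n \<and>
     Poly_Mapping.keys G \<inter> P ` {..<n} = {}"

definition ag_code :: "nat \<Rightarrow> (nat \<Rightarrow> 'f set) \<Rightarrow> ('f set \<Rightarrow>\<^sub>0 int) \<Rightarrow> 'q vec set" where
  "ag_code n P G = (\<lambda>f. vec n (\<lambda>j. eval_at f (P j))) ` riemann_roch_space G"

end

section \<open>Families of codes\<close>

text \<open>A family with lengths \<open>N i\<close>, dimensions \<open>K i\<close> and minimum distances \<open>D i\<close> has
  information rate \<open>R\<close> and relative minimum distance \<open>\<delta>\<close>.\<close>

definition family_rates ::
    "(nat \<Rightarrow> nat) \<Rightarrow> (nat \<Rightarrow> nat) \<Rightarrow> (nat \<Rightarrow> nat) \<Rightarrow> real \<Rightarrow> real \<Rightarrow> bool" where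
  "family_rates N K D R \<delta> \<longleftrightarrow>
     filterlim N at_top sequentially \<and>
     (\<lambda>i. real (K i) / real (N i)) \<longlonglongrightarrow> R \<and>
     (\<lambda>i. real (D i) / real (N i)) \<longlonglongrightarrow> \<delta>"

definition attains_TVZ ::
    "nat \<Rightarrow> (nat \<Rightarrow> nat) \<Rightarrow> (nat \<Rightarrow> nat) \<Rightarrow> (nat \<Rightarrow> nat) \<Rightarrow> bool" where
  "attains_TVZ Q N K D \<longleftrightarrow>
     (\<exists>R \<delta>. family_rates N K D R \<delta> \<and> R \<ge> 1 - 1 / (sqrt (real Q) - 1) - \<delta>)"

end

theory Submission
  imports Defs
begin

text \<open>
  The rate and the relative distance of the outer codes are both halved by the inner code, so the
  Tsfasman--Vladut--Zink bound \<open>2/3\<close> for their sum becomes \<open>1/3\<close>. The dimension of a concatenated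
  code is found by counting words: \<open>16 ^ k = 2 ^ (4 * k)\<close>. A coordinate of the concatenated code is
  repaired inside its own block by one of the weight-4 words of the dual of the extended Hamming code.
\<close>

section \<open>Counting the words of a linear code\<close>

text \<open>Coordinates with respect to a basis identify the vectors with the functions from the
  basis to the scalars. This lets a dimension be read off from a cardinality.\<close>

lemma card_vectorspace:
  assumes "vectorspace K V" "finite (carrier V)"
  shows "card (carrier V) = card (carrier K) ^ vectorspace.dim K V"
proof -
  interpret vectorspace K V by (fact assms(1))
  \<comment> \<open>The finite carrier is itself a finite spanning set, so a finite basis
    exists.\<close>
  have "span (carrier V) = carrier V"
    by (rule equalityI[OF span_is_subset2[OF subset_refl] in_own_span[OF subset_refl]])
  then have "fin_dim"
    unfolding fin_dim_def using assms(2) by blast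
  then obtain B where B: "finite B" "basis B"
    using finite_basis_exists by blast
  then have BV: "B \<subseteq> carrier V" by (simp add: basis_def)
  then have "\<forall>v. v \<in> carrier V \<longrightarrow> (\<exists>!a. a \<in> B \<rightarrow>\<^sub>E carrier K \<and> lincomb a B = v)"
    using basis_criterion[OF B(1) BV] B(2) by simp
  moreover have "lincomb a B \<in> carrier V" if "a \<in> B \<rightarrow>\<^sub>E carrier K" for a
    using that BV by (intro lincomb_closed) auto
  ultimately have "bij_betw (\<lambda>a. lincomb a B) (B \<rightarrow>\<^sub>E carrier K) (carrier V)"
    unfolding bij_betw_def inj_on_def image_def by blast
  then have "card (carrier V) = card (B \<rightarrow>\<^sub>E carrier K)"
    by (simp add: bij_betw_same_card)
  also have "\<dots> = card (carrier K) ^ dim"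
    using B dim_basis by (simp add: card_funcsetE)
  finally show ?thesis .
qed

lemma finite_carrier_vec:
  assumes "finite (UNIV :: 'a set)"
  shows "finite (carrier_vec n :: 'a vec set)"
proof -
  \<comment> \<open>Restricting the coordinate function to \<open>{..<n}\<close> makes it
    extensional, so every vector comes from one of finitely many functions.\<close>
  have "x \<in> vec n ` ({..<n} \<rightarrow>\<^sub>E UNIV)" if "x \<in> carrier_vec n" for x :: "'a vec"
    using that
    by (intro image_eqI[where x = "restrict (\<lambda>i. x $ i) {..<n}"]) auto
  moreover have "finite (vec n ` ({..<n} \<rightarrow>\<^sub>E (UNIV :: 'a set)))"
    using assms by (intro finite_imageI finite_PiE) auto
  ultimately show ?thesis
    by (meson finite_subset subsetI)
qed

text \<open>Together with its converse \<open>subspace_vecD\<close>, this replaces the record-based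
  notion of subspace by closure under the ordinary vector operations.\<close>

lemma subspace_vecI:
  fixes C :: "'a::field vec set"
  assumes "C \<subseteq> carrier_vec n" "0\<^sub>v n \<in> C"
    and "\<And>u v. u \<in> C \<Longrightarrow> v \<in> C \<Longrightarrow> u + v \<in> C"
    and "\<And>a v. v \<in> C \<Longrightarrow> a \<cdot>\<^sub>v v \<in> C"
  shows "VectorSpace.subspace class_ring C (module_vec TYPE('a) n)"
proof -
  have "module class_ring (module_vec TYPE('a) n)"
    using vec_vs by (rule vectorspace.axioms)
  then show ?thesis
    by (intro subspace.intro vec_vs submodule.intro)
      (simp_all add: assms module_vec_simps class_ring_simps)
qed

lemma subspace_vecD:
  fixes C :: "'a::field vec set"
  assumes "VectorSpace.subspace class_ring C (module_vec TYPE('a) n)"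
  shows "C \<subseteq> carrier_vec n" "0\<^sub>v n \<in> C"
    and "u \<in> C \<Longrightarrow> v \<in> C \<Longrightarrow> u + v \<in> C"
    and "v \<in> C \<Longrightarrow> a \<cdot>\<^sub>v v \<in> C"
proof -
  interpret submodule class_ring C "module_vec TYPE('a) n"
    using assms by (simp add: VectorSpace.subspace_def)
  show "C \<subseteq> carrier_vec n" "0\<^sub>v n \<in> C"
    and "u \<in> C \<Longrightarrow> v \<in> C \<Longrightarrow> u + v \<in> C"
    and "v \<in> C \<Longrightarrow> a \<cdot>\<^sub>v v \<in> C"
    using subset zero_closed m_closed smult_closed
    by (auto simp: module_vec_simps class_ring_simps)
qed

lemma card_subspace_vec:
  fixes C :: "'a::field vec set"
  assumes "finite (UNIV :: 'a set)"
    and "VectorSpace.subspace class_ring C (module_vec TYPE('a) n)"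
  shows "card C = card (UNIV :: 'a set) ^ vectorspace.dim class_ring ((module_vec TYPE('a) n)\<lparr>carrier := C\<rparr>)"
proof -
  have "finite C"
    using finite_subset[OF subspace_vecD(1)[OF assms(2)] finite_carrier_vec[OF assms(1)]] .
  moreover have "vectorspace class_ring ((module_vec TYPE('a) n)\<lparr>carrier := C\<rparr>)"
    using vectorspace.subspace_is_vs[OF vec_vs assms(2)] .
  ultimately show ?thesis
    using card_vectorspace[of class_ring "(module_vec TYPE('a) n)\<lparr>carrier := C\<rparr>"]
    by (simp add: class_ring_simps)
qed

text \<open>A nonempty set of natural numbers has a least element. This supplies a minimum distance
  for a code whose exact distance is not computed.\<close>

lemma has_min_distanceE:
  assumes "u \<in> C" "v \<in> C" "u \<noteq> v"
  obtains d where "has_min_distance C d"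
proof -
  define Q where "Q d \<longleftrightarrow> (\<exists>u\<in>C. \<exists>v\<in>C. u \<noteq> v \<and> hamming_distance u v = d)" for d
  have "Q (hamming_distance u v)"
    unfolding Q_def using assms by blast
  then have "Q (LEAST d. Q d)" by (rule LeastI)
  moreover have "(LEAST d. Q d) \<le> d" if "Q d" for d
    using that by (rule Least_le)
  ultimately have "has_min_distance C (LEAST d. Q d)"
    unfolding has_min_distance_def Q_def by blast
  then show thesis by (rule that)
qed

section \<open>The extended Hamming code\<close>

lemma bit_add_eq_0_iff: "a + b = 0 \<longleftrightarrow> a = b" for a b :: bit
  by (cases a; cases b) simp_all

text \<open>Each \<open>T\<close> supports a dual word with all nonzero entries \<open>1\<close> and
  weight at most \<open>r + 1\<close>. The check expresses coordinate \<open>i\<close> through the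
  others, so \<open>T - {i}\<close> is a recovery set.\<close>

lemma has_locality_if_checks:
  fixes C :: "'a::ab_group_add vec set"
  assumes "\<And>i. i < n \<Longrightarrow> \<exists>T\<subseteq>{..<n}. i \<in> T \<and> card T \<le> Suc r \<and> (\<forall>x\<in>C. (\<Sum>j\<in>T. x $ j) = 0)"
  shows "has_locality n C r"
  unfolding has_locality_def
proof (intro allI impI)
  fix i
  assume "i < n"
  from assms[OF this] obtain T where T: "T \<subseteq> {..<n}" "i \<in> T" "card T \<le> Suc r"
    and check: "\<And>x. x \<in> C \<Longrightarrow> (\<Sum>j\<in>T. x $ j) = 0"
    by blast
  have "finite T"
    using T(1) finite_subset by blast
  have split: "(\<Sum>j\<in>T. w $ j) = w $ i + (\<Sum>j\<in>T - {i}. w $ j)" for w :: "'a vec"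
    by (rule sum.remove[OF \<open>finite T\<close> T(2)])
  have "u $ i = v $ i" if "u \<in> C" "v \<in> C" "\<forall>j\<in>T - {i}. u $ j = v $ j" for u v
  proof -
    have "u $ i + (\<Sum>j\<in>T - {i}. u $ j) = v $ i + (\<Sum>j\<in>T - {i}. v $ j)"
      using check[OF that(1)] check[OF that(2)] by (simp only: split)
    moreover have "(\<Sum>j\<in>T - {i}. u $ j) = (\<Sum>j\<in>T - {i}. v $ j)"
      using that(3) by (intro sum.cong) simp_all
    ultimately show ?thesis by simp
  qed
  moreover have "T - {i} \<subseteq> {..<n} - {i}"
    using T(1) by blast
  moreover have "card (T - {i}) \<le> r"
    using T(2,3) by simp
  ultimately show "\<exists>S\<subseteq>{..<n} - {i}. card S \<le> r \<and>
      (\<forall>u\<in>C. \<forall>v\<in>C. (\<forall>j\<in>S. u $ j = v $ j) \<longrightarrow> u $ i = v $ i)"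
    by blast
qed

text \<open>The last check is the overall parity check minus the first check of the Hamming code, so
  that all four have weight 4.\<close>

lemma extended_hamming_code_checks:
  assumes "x \<in> extended_hamming_code"
  shows "x \<in> carrier_vec 8"
    and "x $ 0 = x $ 2 + x $ 4 + x $ 6"
    and "x $ 1 = x $ 2 + x $ 5 + x $ 6"
    and "x $ 3 = x $ 4 + x $ 5 + x $ 6"
    and "x $ 7 = x $ 1 + x $ 3 + x $ 5"
proof -
  obtain y where y: "y \<in> carrier_vec 7" "hamming_parity_check 3 *\<^sub>v y = 0\<^sub>v 3"
    and x: "x = extend_by_parity y"
    using assms by (auto simp: extended_hamming_code_def hamming_code_def)
  show "x \<in> carrier_vec 8"
    using y(1) x by (auto simp: extend_by_parity_def intro!: carrier_vecI)
  have xy: "x $ j = y $ j" if "j < 7" for j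
    using that y(1) x by (simp add: extend_by_parity_def)
  have x7: "x $ 7 = (\<Sum>j<7. x $ j)"
    using y(1) x by (simp add: extend_by_parity_def)
  \<comment> \<open>Column \<open>j\<close> holds the binary digits of \<open>j + 1\<close>: indices
    start at 0, while the columns run through 1 to 7.\<close>
  have row: "(\<Sum>j\<in>{0..<7}. of_bool (odd (Suc j div 2 ^ b)) * x $ j) = 0" if "b < 3" for b
  proof -
    have "(hamming_parity_check 3 *\<^sub>v y) $ b = 0"
      using y(2) that by simp
    then show ?thesis
      using that y(1) by (simp add: hamming_parity_check_def scalar_prod_def xy)
  qed
  have seven: "sum f {0..<7} = f 0 + f 1 + f 2 + f 3 + f 4 + f 5 + f 6"
    "sum f {..<7} = f 0 + f 1 + f 2 + f 3 + f 4 + f 5 + f 6" for f :: "nat \<Rightarrow> bit"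
    by (simp_all add: eval_nat_numeral)
  have solve: "a = b + c + d" if "a + b + c + d = 0" for a b c d :: bit
    using that by (simp only: add.assoc bit_add_eq_0_iff)
  have "x $ 0 + x $ 2 + x $ 4 + x $ 6 = 0" "x $ 1 + x $ 2 + x $ 5 + x $ 6 = 0"
    "x $ 3 + x $ 4 + x $ 5 + x $ 6 = 0"
    using row[of 0, unfolded seven] row[of 1, unfolded seven] row[of 2, unfolded seven]
    by simp_all
  then show first: "x $ 0 = x $ 2 + x $ 4 + x $ 6" and "x $ 1 = x $ 2 + x $ 5 + x $ 6"
    and "x $ 3 = x $ 4 + x $ 5 + x $ 6"
    by (blast intro: solve)+
  \<comment> \<open>The parity bit is the sum of the first seven coordinates; grouped this way, the
    part in the first check cancels in characteristic two.\<close>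
  have "x $ 7 = x $ 0 + (x $ 2 + x $ 4 + x $ 6) + (x $ 1 + x $ 3 + x $ 5)"
    unfolding x7 seven by (simp only: ac_simps)
  then show "x $ 7 = x $ 1 + x $ 3 + x $ 5"
    by (simp only: first[symmetric] bit_add_eq_0_iff[THEN iffD2, OF refl] add_0)
qed

lemma extended_hamming_code_distance:
  assumes "u \<in> extended_hamming_code" "v \<in> extended_hamming_code" "u \<noteq> v"
  shows "4 \<le> hamming_distance u v"
proof -
  \<comment> \<open>Over \<open>bit\<close> the sum of two words is their difference, so
    \<open>e\<close> is nonzero exactly where they differ, and it satisfies the same checks.\<close>
  define e where "e i = u $ i + v $ i" for i
  note u = extended_hamming_code_checks[OF assms(1)]
  note v = extended_hamming_code_checks[OF assms(2)]
  have e: "e 0 = e 2 + e 4 + e 6" "e 1 = e 2 + e 5 + e 6" "e 3 = e 4 + e 5 + e 6"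
    "e 7 = e 1 + e 3 + e 5"
    unfolding e_def u(2-) v(2-) by (simp_all only: ac_simps)
  have sum8: "sum f {..<8} = f 0 + f 1 + f 2 + f 3 + f 4 + f 5 + f 6 + f 7"
    for f :: "nat \<Rightarrow> nat"
    by (simp add: eval_nat_numeral)
  have "hamming_distance u v = card {i \<in> {..<8}. e i \<noteq> 0}"
    unfolding hamming_distance_def e_def bit_add_eq_0_iff using u(1) by simp
  also have "\<dots> = (\<Sum>i<8. of_bool (e i \<noteq> 0))"
    by (simp add: of_bool_def flip: sum.inter_filter)
  finally have weight: "hamming_distance u v = (\<Sum>i<8. of_bool (e i \<noteq> 0))" .
  have "hamming_distance u v \<noteq> 0"
    using assms(3) u(1) v(1) by (auto simp: hamming_distance_def)
  then show ?thesis
    unfolding weight sum8 e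
    \<comment> \<open>The checks express every coordinate through those at 2, 4, 5 and 6. Of the 16
      assignments, the zero one is excluded by \<open>u \<noteq> v\<close>; all others give weight 4
      or 8.\<close>
    by (cases "e 2"; cases "e 4"; cases "e 5"; cases "e 6"; simp)
qed

text \<open>The bracketing isolates the first summand, so that over \<open>bit\<close> a vanishing
  sum becomes an equation solved for that coordinate.\<close>

lemma sum_four:
  fixes f :: "'b \<Rightarrow> 'a::comm_monoid_add"
  assumes "distinct [a, b, c, d]"
  shows "sum f {a, b, c, d} = f a + (f b + f c + f d)"
  using assms by (simp add: add.assoc)

lemma extended_hamming_code_locality: "has_locality 8 extended_hamming_code 3"
proof (rule has_locality_if_checks)
  fix i :: nat
  assume "i < 8"
  \<comment> \<open>These are the supports of the four checks, the solved coordinate listed first.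
    They have four elements each and together cover all eight positions.\<close>
  define \<T> :: "nat set set" where "\<T> = {{0, 2, 4, 6}, {1, 2, 5, 6}, {3, 4, 5, 6}, {7, 1, 3, 5}}"
  have "{..<8} = \<Union>\<T>"
    unfolding \<T>_def by auto
  then obtain T where T: "T \<in> \<T>" "i \<in> T" "T \<subseteq> {..<8}"
    using \<open>i < 8\<close> by blast
  moreover have "card T \<le> Suc 3"
    using T(1) by (auto simp: \<T>_def)
  moreover have "(\<Sum>j\<in>T. x $ j) = 0" if "x \<in> extended_hamming_code" for x
  proof -
    have "(\<Sum>j\<in>{a, b, c, d}. x $ j) = 0"
      if "distinct [a, b, c, d]" "x $ a = x $ b + x $ c + x $ d" for a b c d
      by (simp only: sum_four[OF that(1)] bit_add_eq_0_iff that(2))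
    from this[OF _ extended_hamming_code_checks(2)[OF that]]
      this[OF _ extended_hamming_code_checks(3)[OF that]]
      this[OF _ extended_hamming_code_checks(4)[OF that]]
      this[OF _ extended_hamming_code_checks(5)[OF that]]
    show ?thesis
      using T(1) unfolding \<T>_def by fastforce
  qed
  ultimately show "\<exists>T\<subseteq>{..<8}. i \<in> T \<and> card T \<le> Suc 3 \<and>
      (\<forall>x\<in>extended_hamming_code. (\<Sum>j\<in>T. x $ j) = 0)"
    by blast
qed

section \<open>Concatenation\<close>

text \<open>Every outer coordinate at which \<open>u\<close> and \<open>v\<close> differ yields a
  block with at least \<open>d1\<close> differing positions, and distinct blocks are
  disjoint.\<close>

lemma concatenated_code_distance:
  fixes \<phi> :: "'e \<Rightarrow> 'b vec"
  assumes inner: "\<And>x y. x \<noteq> y \<Longrightarrow> d1 \<le> hamming_distance (\<phi> x) (\<phi> y)"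
    and dim: "\<And>x. dim_vec (\<phi> x) = n1"
    and u: "u \<in> carrier_vec n2" and v: "v \<in> carrier_vec n2"
  shows "d1 * hamming_distance u v \<le>
    hamming_distance (vec (n1 * n2) (\<lambda>i. \<phi> (u $ (i div n1)) $ (i mod n1)))
      (vec (n1 * n2) (\<lambda>i. \<phi> (v $ (i div n1)) $ (i mod n1)))"
    (is "_ \<le> hamming_distance ?u ?v")
proof -
  define J where "J = {j. j < n2 \<and> u $ j \<noteq> v $ j}"
  define B where "B j = {b. b < n1 \<and> \<phi> (u $ j) $ b \<noteq> \<phi> (v $ j) $ b}" for j
  have "d1 * hamming_distance u v = (\<Sum>j\<in>J. d1)"
    using u by (simp add: hamming_distance_def J_def)
  also have "\<dots> \<le> (\<Sum>j\<in>J. card (B j))"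
    using inner dim by (intro sum_mono) (auto simp: J_def B_def hamming_distance_def)
  also have "\<dots> = card (SIGMA j:J. B j)"
    by (simp add: J_def B_def)
  also have "\<dots> = card ((\<lambda>(j, b). n1 * j + b) ` (SIGMA j:J. B j))"
  proof (rule card_image[symmetric], rule inj_onI, clarify)
    fix j b j' b'
    assume "b \<in> B j" "b' \<in> B j'" and eq: "n1 * j + b = n1 * j' + b'"
    then have "b < n1" "b' < n1" by (auto simp: B_def)
    \<comment> \<open>Quotient and remainder by \<open>n1\<close> recover the block and the offset,
      so no position is counted twice.\<close>
    then show "j = j' \<and> b = b'"
      using arg_cong[OF eq, of "\<lambda>i. i div n1"] arg_cong[OF eq, of "\<lambda>i. i mod n1"] by simp
  qed
  also have "\<dots> \<le> card {i. i < dim_vec ?u \<and> ?u $ i \<noteq> ?v $ i}"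
  proof (rule card_mono)
    have "n1 * j + b < n1 * n2" if "j < n2" "b < n1" for j b
    proof -
      have "n1 * j + b < n1 * Suc j" using that by simp
      also have "\<dots> \<le> n1 * n2" using that by (intro mult_le_mono2) simp
      finally show ?thesis .
    qed
    then show "(\<lambda>(j, b). n1 * j + b) ` (SIGMA j:J. B j) \<subseteq> {i. i < dim_vec ?u \<and> ?u $ i \<noteq> ?v $ i}"
      by (auto simp: J_def B_def)
  qed simp
  finally show ?thesis
    by (simp add: hamming_distance_def)
qed

text \<open>Position \<open>i\<close> has offset \<open>i mod n1\<close> in block
  \<open>i div n1\<close>. The inner recovery set for that offset, translated into the block,
  recovers \<open>i\<close>.\<close>

lemma concatenated_code_locality:
  fixes \<phi> :: "'e \<Rightarrow> 'b vec"
  assumes inner: "has_locality n1 C1 r" and "range \<phi> \<subseteq> C1"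
  shows "has_locality (n1 * n2) (concatenated_code n1 n2 \<phi> C) r"
  unfolding has_locality_def
proof (intro allI impI)
  fix i
  assume i: "i < n1 * n2"
  then have "n1 > 0" by (cases n1) auto
  then have "i mod n1 < n1" by simp
  have block: "n1 * (i div n1) + b < n1 * n2" if "b < n1" for b
  proof -
    have "i div n1 < n2"
      using i by (simp add: less_mult_imp_div_less mult.commute)
    then have "n1 * Suc (i div n1) \<le> n1 * n2" by (intro mult_le_mono2) simp
    then show ?thesis using that by simp
  qed
  obtain S where S: "S \<subseteq> {..<n1} - {i mod n1}" "card S \<le> r"
    and rec: "\<And>u v. u \<in> C1 \<Longrightarrow> v \<in> C1 \<Longrightarrow> \<forall>j\<in>S. u $ j = v $ j \<Longrightarrow> u $ (i mod n1) = v $ (i mod n1)"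
    using inner \<open>i mod n1 < n1\<close> unfolding has_locality_def by meson
  define T where "T = (\<lambda>b. n1 * (i div n1) + b) ` S"
  have "T \<subseteq> {..<n1 * n2} - {i}"
  proof
    fix t
    assume "t \<in> T"
    then obtain b where b: "b \<in> S" "t = n1 * (i div n1) + b" by (auto simp: T_def)
    then have "b < n1" "b \<noteq> i mod n1" using S(1) by auto
    \<comment> \<open>The translate of \<open>b\<close> has residue \<open>b\<close>, which differs
      from that of \<open>i\<close>; hence the translated set avoids \<open>i\<close>.\<close>
    then have "t < n1 * n2" "t mod n1 \<noteq> i mod n1" using b block by auto
    then show "t \<in> {..<n1 * n2} - {i}" by auto
  qed
  moreover have "card T \<le> r"
    using S card_image_le[of S] finite_subset[OF S(1)] unfolding T_def
    by (meson finite_Diff finite_lessThan le_trans)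
  moreover have "u $ i = v $ i"
    if u: "u \<in> concatenated_code n1 n2 \<phi> C" and v: "v \<in> concatenated_code n1 n2 \<phi> C"
      and eq: "\<forall>j\<in>T. u $ j = v $ j" for u v
  proof -
    obtain c c' where uc: "u = vec (n1 * n2) (\<lambda>i. \<phi> (c $ (i div n1)) $ (i mod n1))"
      and vc: "v = vec (n1 * n2) (\<lambda>i. \<phi> (c' $ (i div n1)) $ (i mod n1))"
      using u v by (auto simp: concatenated_code_def)
    have "\<phi> (c $ (i div n1)) $ b = \<phi> (c' $ (i div n1)) $ b" if "b \<in> S" for b
    proof -
      have b: "b < n1" using that S(1) by auto
      have "u $ (n1 * (i div n1) + b) = v $ (n1 * (i div n1) + b)"
        using eq that by (auto simp: T_def)
      then show ?thesis using b block[OF b] by (simp add: uc vc)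
    qed
    then have "\<phi> (c $ (i div n1)) $ (i mod n1) = \<phi> (c' $ (i div n1)) $ (i mod n1)"
      using assms(2) by (intro rec) auto
    then show ?thesis using i by (simp add: uc vc)
  qed
  ultimately show "\<exists>S\<subseteq>{..<n1 * n2} - {i}. card S \<le> r \<and>
      (\<forall>u\<in>concatenated_code n1 n2 \<phi> C. \<forall>v\<in>concatenated_code n1 n2 \<phi> C.
        (\<forall>j\<in>S. u $ j = v $ j) \<longrightarrow> u $ i = v $ i)"
    by blast
qed

text \<open>Blockwise encoding is additive and turns multiplication by \<open>emb a\<close> into
  multiplication by \<open>a\<close>, so closure over the large field passes to closure over the
  small one.\<close>

lemma concatenated_code_subspace:
  fixes \<phi> :: "'e::field \<Rightarrow> 'b::field vec"
  assumes sub: "VectorSpace.subspace class_ring C (module_vec TYPE('e) n2)"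
    and dim: "\<And>x. dim_vec (\<phi> x) = n1"
    and add: "\<And>x y. \<phi> (x + y) = \<phi> x + \<phi> y"
    and smult: "\<And>a x. \<phi> (emb a * x) = a \<cdot>\<^sub>v \<phi> x"
  shows "VectorSpace.subspace class_ring (concatenated_code n1 n2 \<phi> C) (module_vec TYPE('b) (n1 * n2))"
proof -
  define enc where "enc c = vec (n1 * n2) (\<lambda>i. \<phi> (c $ (i div n1)) $ (i mod n1))" for c
  note C = subspace_vecD[OF sub]
  have idx: "i div n1 < n2" "i mod n1 < n1" if "i < n1 * n2" for i
    using that by (cases n1; simp add: less_mult_imp_div_less mult.commute)+
  have zero: "\<phi> 0 = 0\<^sub>v n1"
  proof -
    \<comment> \<open>With scalar and argument both 0, \<open>smult\<close> exhibits
      \<open>\<phi> 0\<close> as the zero multiple of a vector.\<close>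
    have "\<phi> 0 $ i = 0" if "i < n1" for i
      using arg_cong[OF smult[of 0 0], of "\<lambda>x. x $ i"] that dim by simp
    then show ?thesis using dim by auto
  qed
  have enc_add: "enc u + enc v = enc (u + v)" if "u \<in> C" "v \<in> C" for u v
    using that C(1) idx by (intro eq_vecI) (auto simp: enc_def add dim subset_iff)
  have enc_smult: "a \<cdot>\<^sub>v enc v = enc (emb a \<cdot>\<^sub>v v)" if "v \<in> C" for a v
    using that C(1) idx by (intro eq_vecI) (auto simp: enc_def smult dim subset_iff)
  have enc_zero: "0\<^sub>v (n1 * n2) = enc (0\<^sub>v n2)"
    using idx by (intro eq_vecI) (auto simp: enc_def zero)
  have "concatenated_code n1 n2 \<phi> C = enc ` C"
    by (simp add: concatenated_code_def enc_def)
  moreover have "VectorSpace.subspace class_ring (enc ` C) (module_vec TYPE('b) (n1 * n2))"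
  proof (rule subspace_vecI)
    show "enc ` C \<subseteq> carrier_vec (n1 * n2)" by (auto simp: enc_def)
    show "0\<^sub>v (n1 * n2) \<in> enc ` C" using C(2) enc_zero by auto
  qed (use C enc_add enc_smult in auto)
  ultimately show ?thesis by simp
qed

text \<open>The dimension follows from counting words, as encoding is injective. The distance is
  only bounded below by \<open>d1 * d2\<close>: a pair of outer words at distance \<open>d2\<close>
  need not differ by inner words of least weight.\<close>

lemma concatenated_code_linear:
  fixes \<phi> :: "'e::field \<Rightarrow> 'b::field vec"
  assumes outer: "linear_code n2 k2 d2 C"
    and iso: "linear_iso emb \<phi> C1" and C1: "C1 \<subseteq> carrier_vec n1"
    and inner: "\<And>u v. u \<in> C1 \<Longrightarrow> v \<in> C1 \<Longrightarrow> u \<noteq> v \<Longrightarrow> d1 \<le> hamming_distance u v"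
    and "d1 > 0"
    and fin: "finite (UNIV :: 'b set)" and card: "card (UNIV :: 'e set) = card (UNIV :: 'b set) ^ k1"
  obtains D where "d1 * d2 \<le> D"
    and "linear_code (n1 * n2) (k1 * k2) D (concatenated_code n1 n2 \<phi> C)"
proof -
  define enc where "enc c = vec (n1 * n2) (\<lambda>i. \<phi> (c $ (i div n1)) $ (i mod n1))" for c
  have code: "concatenated_code n1 n2 \<phi> C = enc ` C"
    by (simp add: concatenated_code_def enc_def)
  have bij: "bij_betw \<phi> UNIV C1" and add: "\<And>x y. \<phi> (x + y) = \<phi> x + \<phi> y"
    and smult: "\<And>a x. \<phi> (emb a * x) = a \<cdot>\<^sub>v \<phi> x"
    using iso by (auto simp: linear_iso_def)
  have \<phi>: "\<phi> x \<in> C1" for x using bij by (auto simp: bij_betw_def)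
  have dim: "dim_vec (\<phi> x) = n1" for x using C1 \<phi> carrier_vecD by blast
  have sub: "VectorSpace.subspace class_ring C (module_vec TYPE('e) n2)"
    and k2: "vectorspace.dim class_ring ((module_vec TYPE('e) n2)\<lparr>carrier := C\<rparr>) = k2"
    and d2: "has_min_distance C d2"
    using outer by (auto simp: linear_code_def)
  note C = subspace_vecD[OF sub]
  have sub': "VectorSpace.subspace class_ring (enc ` C) (module_vec TYPE('b) (n1 * n2))"
    using concatenated_code_subspace[OF sub dim add smult] by (simp add: code)
  have inner': "d1 \<le> hamming_distance (\<phi> x) (\<phi> y)" if "x \<noteq> y" for x y
    using that bij inner[OF \<phi> \<phi>] by (auto simp: bij_betw_def dest: injD)
  have dist: "d1 * hamming_distance u v \<le> hamming_distance (enc u) (enc v)"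
    if "u \<in> C" "v \<in> C" for u v
    unfolding enc_def using that C(1) inner' dim
    by (intro concatenated_code_distance) auto
  have self: "hamming_distance w w = 0" for w :: "'b vec"
    by (simp add: hamming_distance_def)
  have pos: "0 < hamming_distance u v" if "u \<in> C" "v \<in> C" "u \<noteq> v" for u v
  proof -
    have dims: "dim_vec u = n2" "dim_vec v = n2" using that C(1) by auto
    then obtain i where "i < n2" "u $ i \<noteq> v $ i" using \<open>u \<noteq> v\<close> eq_vecI by metis
    then show ?thesis using dims by (auto simp: hamming_distance_def card_gt_0_iff)
  qed
  \<comment> \<open>Distinct outer words are at positive distance, and \<open>d1 > 0\<close> keeps
    their encodings at positive distance.\<close>
  have inj: "inj_on enc C"
  proof (rule inj_onI, rule ccontr)
    fix u v
    assume "u \<in> C" "v \<in> C" "enc u = enc v" "u \<noteq> v"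
    then show False using dist[of u v] pos[of u v] \<open>d1 > 0\<close> self by simp
  qed
  obtain u v where uv: "u \<in> C" "v \<in> C" "u \<noteq> v"
    using d2 by (auto simp: has_min_distance_def)
  then have "enc u \<noteq> enc v" using inj by (auto dest: inj_onD)
  then obtain D where D: "has_min_distance (enc ` C) D"
    using has_min_distanceE uv by (metis imageI)
  then obtain a b where ab: "a \<in> C" "b \<in> C" "a \<noteq> b" "D = hamming_distance (enc a) (enc b)"
    by (auto simp: has_min_distance_def)
  then have "d2 \<le> hamming_distance a b"
    using d2 by (auto simp: has_min_distance_def)
  then have "d1 * d2 \<le> D"
    using dist[OF ab(1,2)] ab(4) by (meson le_trans mult_le_mono2)
  \<comment> \<open>Having at least two scalars makes the cardinality of \<open>'e\<close> positive,
    hence \<open>'e\<close> finite, and later allows exponents to be compared.\<close>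
  have b2: "card (UNIV :: 'b set) \<ge> 2"
    using fin card_mono[OF fin, of "{0, 1}"] by simp
  then have fin': "finite (UNIV :: 'e set)"
    using card by (intro card_ge_0_finite) simp
  let ?k = "vectorspace.dim class_ring ((module_vec TYPE('b) (n1 * n2))\<lparr>carrier := enc ` C\<rparr>)"
  have "card (UNIV :: 'b set) ^ ?k = card (enc ` C)"
    using card_subspace_vec[OF fin sub'] by simp
  also have "\<dots> = card C" using inj by (rule card_image)
  also have "\<dots> = card (UNIV :: 'b set) ^ (k1 * k2)"
    using card_subspace_vec[OF fin' sub] k2 by (simp add: card power_mult)
  finally have "?k = k1 * k2"
    using b2 by simp
  then have "linear_code (n1 * n2) (k1 * k2) D (concatenated_code n1 n2 \<phi> C)"
    using sub' D by (simp add: linear_code_def code)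
  then show thesis using \<open>d1 * d2 \<le> D\<close> that by blast
qed

section \<open>Asymptotic rates\<close>

lemma family_rates_scale:
  assumes "family_rates n k d R \<delta>" "a > 0"
  shows "family_rates (\<lambda>i. a * n i) (\<lambda>i. b * k i) (\<lambda>i. c * d i)
    (real b / real a * R) (real c / real a * \<delta>)"
proof -
  have "filterlim n at_top sequentially"
    using assms by (simp add: family_rates_def)
  then have "filterlim (\<lambda>i. a * n i) at_top sequentially"
    using assms(2) by (elim filterlim_at_top_mono) simp
  moreover have "(\<lambda>i. real (b * k i) / real (a * n i)) \<longlonglongrightarrow> real b / real a * R"
    "(\<lambda>i. real (c * d i) / real (a * n i)) \<longlonglongrightarrow> real c / real a * \<delta>"
    using assms tendsto_mult_left[of "\<lambda>i. real (k i) / real (n i)" R sequentially "real b / real a"]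
      tendsto_mult_left[of "\<lambda>i. real (d i) / real (n i)" \<delta> sequentially "real c / real a"]
    by (simp_all add: family_rates_def)
  ultimately show ?thesis by (simp add: family_rates_def)
qed

text \<open>Only a lower bound for the true distances is known. Raising the distances cannot lower
  their limit, and uniqueness of limits fixes the rate.\<close>

lemma family_rates_mono:
  assumes "family_rates N K D R \<delta>" "family_rates N K D' R' \<delta>'" "\<And>i. D i \<le> D' i"
  shows "R' = R" "\<delta> \<le> \<delta>'"
proof -
  show "R' = R"
    using assms(1,2) LIMSEQ_unique by (auto simp: family_rates_def)
  have "real (D i) / real (N i) \<le> real (D' i) / real (N i)" for i
    using assms(3) by (simp add: divide_right_mono)
  then show "\<delta> \<le> \<delta>'"
    using assms(1,2) by (auto simp: family_rates_def intro: LIMSEQ_le)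
qed

text \<open>The exact distances \<open>D i\<close> are only known to be at least
  \<open>4 * d i\<close>. Hence the bound appears twice: for the guaranteed distances, whose limits
  exist, and for \<open>D\<close> whenever its limits exist.\<close>

theorem proposition3p8:
  fixes F :: "nat \<Rightarrow> 'f ring"
    and const :: "nat \<Rightarrow> 'q::field \<Rightarrow> 'f"
    and P :: "nat \<Rightarrow> nat \<Rightarrow> 'f set"
    and G :: "nat \<Rightarrow> ('f set \<Rightarrow>\<^sub>0 int)"
    and n k d :: "nat \<Rightarrow> nat"
    and C_out :: "nat \<Rightarrow> 'q vec set"
    and emb :: "bit \<Rightarrow> 'q"
    and \<phi> :: "nat \<Rightarrow> 'q \<Rightarrow> bit vec"
    and C :: "nat \<Rightarrow> bit vec set"
  assumes "card (UNIV :: 'q set) = 2 ^ 4"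
    and "\<And>i. function_field (F i) (const i)"
    and "\<And>i. function_field.ag_code_data (F i) (const i) (n i) (P i) (G i)"
    and "\<And>i. C_out i = function_field.ag_code (F i) (const i) (n i) (P i) (G i)"
    and "\<And>i. linear_code (n i) (k i) (d i) (C_out i)"
    and "attains_TVZ (2 ^ 4) n k d"
    and "field_hom emb"
    and "\<And>i. linear_iso emb (\<phi> i) extended_hamming_code"
    and "\<And>i. C i = concatenated_code 8 (n i) (\<phi> i) (C_out i)"
  shows "\<exists>D. (\<forall>i. 4 * d i \<le> D i \<and>
                locally_repairable_code (8 * n i) (4 * k i) (D i) 3 (C i)) \<and>
             (\<exists>R \<delta>. family_rates (\<lambda>i. 8 * n i) (\<lambda>i. 4 * k i) (\<lambda>i. 4 * d i) R \<delta> \<and>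
                R + \<delta> \<ge> 1 / 3) \<and>
             (\<forall>R \<delta>. family_rates (\<lambda>i. 8 * n i) (\<lambda>i. 4 * k i) D R \<delta> \<longrightarrow> R + \<delta> \<ge> 1 / 3)"
proof -
  have univ: "(UNIV :: bit set) = {0, 1}"
    by (auto intro: bit.exhaust)
  have card_bit: "card (UNIV :: bit set) = 2"
    unfolding univ by simp
  have fin: "finite (UNIV :: bit set)" and card: "card (UNIV :: 'q set) = card (UNIV :: bit set) ^ 4"
    by (simp add: univ) (simp add: assms(1) card_bit)
  have carrier: "extended_hamming_code \<subseteq> carrier_vec 8"
    using extended_hamming_code_checks(1) by blast
  have "\<exists>D. 4 * d i \<le> D \<and> locally_repairable_code (8 * n i) (4 * k i) D 3 (C i)" for i
  proof -
    obtain D where "4 * d i \<le> D"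
      "linear_code (8 * n i) (4 * k i) D (concatenated_code 8 (n i) (\<phi> i) (C_out i))"
      using concatenated_code_linear[OF assms(5)[of i] assms(8)[of i] carrier
        extended_hamming_code_distance _ fin card] by auto
    moreover have "has_locality (8 * n i) (concatenated_code 8 (n i) (\<phi> i) (C_out i)) 3"
      using assms(8)[of i]
      by (intro concatenated_code_locality[OF extended_hamming_code_locality])
        (auto simp: linear_iso_def bij_betw_def)
    ultimately show ?thesis
      using assms(9) by (auto simp: locally_repairable_code_def)
  qed
  then obtain D where D: "\<And>i. 4 * d i \<le> D i"
    "\<And>i. locally_repairable_code (8 * n i) (4 * k i) (D i) 3 (C i)"
    by metis
  obtain R \<delta> where out: "family_rates n k d R \<delta>" "R \<ge> 1 - 1 / (sqrt (real (2 ^ 4)) - 1) - \<delta>"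
    using assms(6) by (auto simp: attains_TVZ_def)
  \<comment> \<open>Here 16 is written as the square of 4; the outer bound becomes
    \<open>1 - 1 / 3 = 2 / 3\<close>.\<close>
  have "sqrt (real (2 ^ 4)) = 4"
    using real_sqrt_abs[of 4] by simp
  then have "R / 2 + \<delta> / 2 \<ge> 1 / 3"
    using out(2) by simp
  \<comment> \<open>Lengths grow by the factor 8, dimensions and guaranteed distances by 4, which
    halves both limits.\<close>
  moreover have rates: "family_rates (\<lambda>i. 8 * n i) (\<lambda>i. 4 * k i) (\<lambda>i. 4 * d i) (R / 2) (\<delta> / 2)"
    using family_rates_scale[OF out(1), of 8 4 4] by simp
  moreover have "R' + \<delta>' \<ge> R / 2 + \<delta> / 2"
    if "family_rates (\<lambda>i. 8 * n i) (\<lambda>i. 4 * k i) D R' \<delta>'" for R' \<delta>'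
    using family_rates_mono[OF rates that D(1)] by simp
  ultimately show ?thesis
    using D by (intro exI[of _ D] conjI allI impI) (blast | fastforce)+
qed

end
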